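(* Let $f$ be an indecomposable finite character on the infinite symmetric inverse semigroup $R_\infty$. There exists $\rho\in[0,1]$ such that for any quasicycle $q=c\cdot\epsilon_{\mathbb{A}}$ with $\mathbb{A}\neq\emptyset$ we have $$f(q)=\rho^{\#({\rm supp}\,c)}.$$
   Context: $R_\infty$ is the semigroup (under matrix multiplication) of all infinite 0-1 matrices $[r_{ij}]_{i,j\in\mathbb{N}}$ with at most one entry 1 in each row and each column and such that $r_{nn}=1$ for all sufficiently large $n$. Its involution is transposition, $[r_{ij}]^\star=[r_{ji}]$ (also written $r^*$). The group $\mathfrak{S}_\infty$ of finitely supported permutations of $\mathbb{N}$ is the subgroup of permutation matrices in $R_\infty$. For a finite $\mathbb{A}\subset\mathbb{N}$, $\epsilon_{\mathbb{A}}\in R_\infty$ is the diagonal matrix whose $i$th diagonal entry is $0$ if $i\in\mathbb{A}$ and $1$ if $i\notin\mathbb{A}$. A quasicycle is an element $c\cdot\epsilon_{\mathbb{A}}$, where $c=(n_1\;n_2\;\cdots\;n_k)$ is a cycle in $\mathfrak{S}_\infty$ and $\mathbb{A}\subseteq{\rm supp}\,c=\{n_1,\ldots,n_k\}$; the length $k=1$ is allowed, so that $\epsilon_{\{n\}}$ is a quasicycle, with $c=(n)$ and the convention ${\rm supp}\,c=\{n\}$. An indecomposable finite character on $R_\infty$ is a function $f:R_\infty\to\mathbb{C}$ that is (1) central: $f(rs)=f(sr)$ for all $r,s$; (2) positive definite: for all $r_1,\ldots,r_n\in R_\infty$ the matrix $[f(r_i^*r_j)]$ is Hermitian and non-negative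 definite; (3) indecomposable: not a sum of two linearly independent functions satisfying (1) and (2); (4) normalized: $f(e)=1$, where $e$ is the identity. *)

theory Defs
  imports Complex_Main "HOL-Combinatorics.Cycles"
begin

definition rook_matrix :: "(nat \<Rightarrow> nat \<Rightarrow> nat) \<Rightarrow> bool" where
  "rook_matrix r \<longleftrightarrow>
     (\<forall>i j. r i j \<in> {0, 1}) \<and>
     (\<forall>i j k. r i j = 1 \<and> r i k = 1 \<longrightarrow> j = k) \<and>
     (\<forall>i j k. r i j = 1 \<and> r k j = 1 \<longrightarrow> i = k) \<and>
     (\<forall>\<^sub>F n in sequentially. r n n = 1)"

definition identity_matrix :: "nat \<Rightarrow> nat \<Rightarrow> nat" where
  "identity_matrix i j = (if i = j then 1 else 0)"

text \<open>
  The matrix product. The formally infinite sum over \<open>k\<close> is restricted to the indices with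
  \<open>r i k \<noteq> 0\<close>, of which a rook matrix has at most one in each row.
\<close>
definition matrix_product ::
    "(nat \<Rightarrow> nat \<Rightarrow> nat) \<Rightarrow> (nat \<Rightarrow> nat \<Rightarrow> nat) \<Rightarrow> nat \<Rightarrow> nat \<Rightarrow> nat" where
  "matrix_product r s i j = (\<Sum>k | r i k \<noteq> 0. r i k * s k j)"

lemma rook_matrix_identity: "rook_matrix identity_matrix"
  by (auto simp: rook_matrix_def identity_matrix_def split: if_splits)

lemma rook_matrix_not_one: "rook_matrix r \<Longrightarrow> r i j \<noteq> 1 \<Longrightarrow> r i j = 0"
  unfolding rook_matrix_def by (meson insertE singletonD)

lemma rook_matrix_row: "rook_matrix r \<Longrightarrow> r i j = 1 \<Longrightarrow> r i k = 1 \<Longrightarrow> j = k"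
  unfolding rook_matrix_def by meson

lemma rook_matrix_col: "rook_matrix r \<Longrightarrow> r i j = 1 \<Longrightarrow> r k j = 1 \<Longrightarrow> i = k"
  unfolding rook_matrix_def by meson

lemma matrix_product_eq_entry:
  assumes "rook_matrix r" "r i k = 1"
  shows "matrix_product r s i j = s k j"
proof -
  have "r i l \<noteq> 0 \<longleftrightarrow> l = k" for l
    using assms rook_matrix_not_one[OF assms(1), of i l] rook_matrix_row[OF assms(1), of i l k]
    by (cases "r i l = 1") auto
  then have "{k. r i k \<noteq> 0} = {k}"
    by simp
  then show ?thesis
    using assms(2) by (simp add: matrix_product_def)
qed

lemma matrix_product_eq_0:
  assumes "rook_matrix r" "\<And>k. r i k \<noteq> 1"
  shows "matrix_product r s i j = 0"
proof -
  have "r i k = 0" for k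
    using rook_matrix_not_one[OF assms] .
  then show ?thesis
    by (simp add: matrix_product_def)
qed

lemma matrix_product_eq_1_iff:
  assumes "rook_matrix r"
  shows "matrix_product r s i j = 1 \<longleftrightarrow> (\<exists>k. r i k = 1 \<and> s k j = 1)"
proof (cases "\<exists>k. r i k = 1")
  case True
  then obtain k where k: "r i k = 1" by blast
  have "l = k" if "r i l = 1" for l
    using rook_matrix_row[OF assms that k] .
  then show ?thesis
    unfolding matrix_product_eq_entry[OF assms k] using k by blast
next
  case False
  then show ?thesis
    using matrix_product_eq_0[OF assms, of i s j] by simp
qed

lemma rook_matrix_product:
  assumes r: "rook_matrix r" and s: "rook_matrix s"
  shows "rook_matrix (matrix_product r s)"
  unfolding rook_matrix_def
proof (intro conjI allI impI)
  show "matrix_product r s i j \<in> {0, 1}" for i j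
  proof (cases "\<exists>k. r i k = 1")
    case True
    then obtain k where "matrix_product r s i j = s k j"
      using matrix_product_eq_entry[OF r] by blast
    then show ?thesis
      using rook_matrix_not_one[OF s, of k j] by (cases "s k j = 1") simp_all
  next
    case False
    then show ?thesis
      using matrix_product_eq_0[OF r, of i s j] by simp
  qed
  show "j = k" if asm: "matrix_product r s i j = 1 \<and> matrix_product r s i k = 1" for i j k
  proof -
    from asm obtain l m where *: "r i l = 1" "s l j = 1" "r i m = 1" "s m k = 1"
      unfolding matrix_product_eq_1_iff[OF r] by blast
    have "l = m"
      by (rule rook_matrix_row[OF r *(1) *(3)])
    then show ?thesis
      using rook_matrix_row[OF s _ *(4)] *(2) by blast
  qed
  show "i = k" if asm: "matrix_product r s i j = 1 \<and> matrix_product r s k j = 1" for i j k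
  proof -
    from asm obtain l m where *: "r i l = 1" "s l j = 1" "r k m = 1" "s m j = 1"
      unfolding matrix_product_eq_1_iff[OF r] by blast
    have "l = m"
      by (rule rook_matrix_col[OF s *(2) *(4)])
    then show ?thesis
      using rook_matrix_col[OF r _ *(3)] *(1) by blast
  qed
  have "\<forall>\<^sub>F n in sequentially. r n n = 1" "\<forall>\<^sub>F n in sequentially. s n n = 1"
    using r s unfolding rook_matrix_def by blast+
  then show "\<forall>\<^sub>F n in sequentially. matrix_product r s n n = 1"
  proof eventually_elim
    case (elim n)
    then show ?case
      unfolding matrix_product_eq_1_iff[OF r] by blast
  qed
qed

lemma rook_matrix_eqI:
  assumes "rook_matrix r" "rook_matrix s" "\<And>i j. r i j = 1 \<longleftrightarrow> s i j = 1"
  shows "r = s"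
proof (intro ext)
  fix i j
  show "r i j = s i j"
    using assms(3)[of i j] rook_matrix_not_one[OF assms(1), of i j]
      rook_matrix_not_one[OF assms(2), of i j]
    by (cases "r i j = 1") simp_all
qed

lemma rook_matrix_transpose: "rook_matrix r \<Longrightarrow> rook_matrix (\<lambda>i j. r j i)"
  unfolding rook_matrix_def by blast

typedef R_inf = "{r. rook_matrix r}" morphisms entry mk_R_inf
  using rook_matrix_identity by blast

lemma rook_matrix_entry [simp]: "rook_matrix (entry r)"
  using entry by blast

instantiation R_inf :: monoid_mult
begin

definition one_R_inf :: R_inf where
  "1 = mk_R_inf identity_matrix"

definition times_R_inf :: "R_inf \<Rightarrow> R_inf \<Rightarrow> R_inf" where
  "r * s = mk_R_inf (matrix_product (entry r) (entry s))"

lemma entry_one: "entry 1 = identity_matrix"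
  by (simp add: one_R_inf_def mk_R_inf_inverse rook_matrix_identity)

lemma entry_times: "entry (r * s) = matrix_product (entry r) (entry s)"
  by (simp add: times_R_inf_def mk_R_inf_inverse rook_matrix_product)

instance
proof
  fix a b c :: R_inf
  have ext: "x = y" if "\<And>i j. entry x i j = 1 \<longleftrightarrow> entry y i j = 1" for x y
    using that rook_matrix_eqI[of "entry x" "entry y"] by (simp add: entry_inject)
  note product_iff = matrix_product_eq_1_iff[OF rook_matrix_entry]
    matrix_product_eq_1_iff[OF rook_matrix_product[OF rook_matrix_entry rook_matrix_entry]]
    matrix_product_eq_1_iff[OF rook_matrix_identity]
  have identity_iff: "identity_matrix i j = 1 \<longleftrightarrow> i = j" for i j
    by (simp add: identity_matrix_def)
  show "a * b * c = a * (b * c)"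
    by (rule ext) (unfold entry_times product_iff, blast)
  show "1 * a = a"
    by (rule ext) (unfold entry_times entry_one product_iff identity_iff, blast)
  show "a * 1 = a"
    by (rule ext) (unfold entry_times entry_one product_iff identity_iff, blast)
qed

end

definition star :: "R_inf \<Rightarrow> R_inf" where
  "star r = mk_R_inf (\<lambda>i j. entry r j i)"

lemma entry_star: "entry (star r) i j = entry r j i"
  by (simp add: star_def mk_R_inf_inverse rook_matrix_transpose)

text \<open>
  \<open>perm_elem \<sigma>\<close> is meaningful only if \<open>\<sigma>\<close> is a finitely supported permutation, and
  \<open>eps A\<close> only if \<open>A\<close> is finite; otherwise the matrix does not belong to \<open>R_inf\<close>.
\<close>
definition perm_elem :: "(nat \<Rightarrow> nat) \<Rightarrow> R_inf" where
  "perm_elem \<sigma> = mk_R_inf (\<lambda>i j. if i = \<sigma> j then 1 else 0)"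

definition eps :: "nat set \<Rightarrow> R_inf" where
  "eps A = mk_R_inf (\<lambda>i j. if i = j \<and> i \<notin> A then 1 else 0)"

lemma entry_perm_elem:
  assumes "\<sigma> permutes S" "finite S"
  shows "entry (perm_elem \<sigma>) i j = (if i = \<sigma> j then 1 else 0)"
proof -
  have "\<forall>\<^sub>F n in sequentially. n \<notin> S"
    using assms(2) by (simp only: eventually_cofinite not_not Collect_mem_eq flip: cofinite_eq_sequentially)
  then have "\<forall>\<^sub>F n in sequentially. (if n = \<sigma> n then 1 else 0) = (1::nat)"
    by eventually_elim (simp add: permutes_not_in[OF assms(1)])
  then have "rook_matrix (\<lambda>i j. if i = \<sigma> j then 1 else 0)"
    using permutes_inj[OF assms(1)] unfolding rook_matrix_def
    by (intro conjI) (auto dest: injD split: if_splits)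
  then show ?thesis
    by (simp add: perm_elem_def mk_R_inf_inverse)
qed

lemma entry_eps:
  assumes "finite A"
  shows "entry (eps A) i j = (if i = j \<and> i \<notin> A then 1 else 0)"
proof -
  have "\<forall>\<^sub>F n in sequentially. n \<notin> A"
    using assms by (simp only: eventually_cofinite not_not Collect_mem_eq flip: cofinite_eq_sequentially)
  then have "\<forall>\<^sub>F n in sequentially. (if n = n \<and> n \<notin> A then 1 else 0) = (1::nat)"
    by eventually_elim simp
  then have "rook_matrix (\<lambda>i j. if i = j \<and> i \<notin> A then 1 else 0)"
    unfolding rook_matrix_def by (intro conjI) simp_all
  then show ?thesis
    by (simp add: eps_def mk_R_inf_inverse)
qed

text \<open>
  A quasicycle is presented by the list \<open>ns\<close> of the entries of its cycle, so that
  \<open>set ns\<close> is the support of the cycle, also for a one-element list, whose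
  \<open>cycle_of_list\<close> is the identity.
\<close>
definition quasicycle :: "nat list \<Rightarrow> nat set \<Rightarrow> R_inf \<Rightarrow> bool" where
  "quasicycle ns A q \<longleftrightarrow>
     ns \<noteq> [] \<and> cycle ns \<and> A \<subseteq> set ns \<and> q = perm_elem (cycle_of_list ns) * eps A"

definition central :: "(R_inf \<Rightarrow> complex) \<Rightarrow> bool" where
  "central f \<longleftrightarrow> (\<forall>r s. f (r * s) = f (s * r))"

definition hermitian_matrix :: "nat \<Rightarrow> (nat \<Rightarrow> nat \<Rightarrow> complex) \<Rightarrow> bool" where
  "hermitian_matrix n M \<longleftrightarrow> (\<forall>i<n. \<forall>j<n. M j i = cnj (M i j))"

text \<open>For a Hermitian matrix the quadratic form is real, so only its real part is constrained.\<close>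
definition nonneg_definite_matrix :: "nat \<Rightarrow> (nat \<Rightarrow> nat \<Rightarrow> complex) \<Rightarrow> bool" where
  "nonneg_definite_matrix n M \<longleftrightarrow>
     (\<forall>z :: nat \<Rightarrow> complex. 0 \<le> Re (\<Sum>i<n. \<Sum>j<n. cnj (z i) * M i j * z j))"

definition positive_definite :: "(R_inf \<Rightarrow> complex) \<Rightarrow> bool" where
  "positive_definite f \<longleftrightarrow>
     (\<forall>n. \<forall>r :: nat \<Rightarrow> R_inf.
        hermitian_matrix n (\<lambda>i j. f (star (r i) * r j)) \<and>
        nonneg_definite_matrix n (\<lambda>i j. f (star (r i) * r j)))"

definition linearly_independent_pair ::
    "(R_inf \<Rightarrow> complex) \<Rightarrow> (R_inf \<Rightarrow> complex) \<Rightarrow> bool" where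
  "linearly_independent_pair g h \<longleftrightarrow>
     (\<forall>a b :: complex. (\<forall>r. a * g r + b * h r = 0) \<longrightarrow> a = 0 \<and> b = 0)"

definition indecomposable :: "(R_inf \<Rightarrow> complex) \<Rightarrow> bool" where
  "indecomposable f \<longleftrightarrow>
     \<not> (\<exists>g h. central g \<and> positive_definite g \<and> central h \<and> positive_definite h \<and>
            linearly_independent_pair g h \<and> (\<forall>r. f r = g r + h r))"

definition indecomposable_finite_character :: "(R_inf \<Rightarrow> complex) \<Rightarrow> bool" where
  "indecomposable_finite_character f \<longleftrightarrow>
     central f \<and> positive_definite f \<and> indecomposable f \<and> f 1 = 1"

end

theory Submission
  imports Defs
begin

text \<open>
  Multiplying by \<open>\<epsilon>\<^bsub>{n}\<^esub>\<close> for a point \<open>n\<close> outside the support of \<open>r\<close> turns \<open>f\<close> into a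
  function \<open>g(r) = f(r \<epsilon>\<^bsub>{n}\<^esub>)\<close> that does not depend on \<open>n\<close>. Since \<open>\<epsilon>\<^bsub>{n}\<^esub>\<close> is a projection
  commuting with \<open>r\<close>, both \<open>g\<close> and \<open>f - g\<close> are central and positive definite. So
  indecomposability forces \<open>g = \<rho> f\<close> with \<open>\<rho> = f(\<epsilon>\<^bsub>{n}\<^esub>)\<close>, and thus
  \<open>f(\<epsilon>\<^bsub>S\<^esub>) = \<rho>\<^bsup>#S\<^esup>\<close>. For a quasicycle, centrality gives
  \<open>f(c \<epsilon>\<^bsub>A\<^esub>) = f(\<epsilon>\<^bsub>A\<^esub> c \<epsilon>\<^bsub>A\<^esub>) = f(c \<epsilon>\<^bsub>B\<^esub>)\<close> with \<open>B = A \<union> c\<^bsup>-1\<^esup>A\<close>; as \<open>c\<close> is transitive on its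
  support, iterating reaches \<open>c \<epsilon>\<^bsub>supp c\<^esub> = \<epsilon>\<^bsub>supp c\<^esub>\<close>.
\<close>

section \<open>Elements as partial bijections\<close>

text \<open>Seen as relations, products become compositions and \<open>star\<close> becomes the
  converse, so identities in the semigroup reduce to first-order reasoning.\<close>

definition rel :: "R_inf \<Rightarrow> nat \<Rightarrow> nat \<Rightarrow> bool" where
  "rel x i j \<longleftrightarrow> entry x i j = 1"

lemma R_inf_eqI: "(\<And>i j. rel x i j \<longleftrightarrow> rel y i j) \<Longrightarrow> x = y"
  using rook_matrix_eqI[of "entry x" "entry y"] by (simp add: rel_def entry_inject)

lemma rel_times: "rel (x * y) i j \<longleftrightarrow> (\<exists>k. rel x i k \<and> rel y k j)"
  unfolding rel_def entry_times by (rule matrix_product_eq_1_iff) simp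

lemma rel_one: "rel 1 i j \<longleftrightarrow> i = j"
  by (simp add: rel_def entry_one identity_matrix_def)

lemma rel_star: "rel (star x) i j \<longleftrightarrow> rel x j i"
  by (simp add: rel_def entry_star)

lemma rel_eps: "finite A \<Longrightarrow> rel (eps A) i j \<longleftrightarrow> i = j \<and> i \<notin> A"
  by (auto simp: rel_def entry_eps)

lemma rel_perm_elem: "\<sigma> permutes S \<Longrightarrow> finite S \<Longrightarrow> rel (perm_elem \<sigma>) i j \<longleftrightarrow> i = \<sigma> j"
  by (simp add: rel_def entry_perm_elem)

lemmas rel_simps = rel_times rel_one rel_star rel_eps

lemma rel_row: "rel x i j \<Longrightarrow> rel x i k \<Longrightarrow> j = k"
  unfolding rel_def using rook_matrix_row rook_matrix_entry by metis

lemma rel_col: "rel x i j \<Longrightarrow> rel x k j \<Longrightarrow> i = k"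
  unfolding rel_def using rook_matrix_col rook_matrix_entry by metis

lemma eventually_rel_refl: "\<forall>\<^sub>F n in sequentially. rel x n n"
  using rook_matrix_entry[of x] unfolding rook_matrix_def rel_def by blast

lemma star_times: "star (x * y) = star y * star x"
  by (rule R_inf_eqI) (auto simp: rel_simps)

lemma star_eps: "finite A \<Longrightarrow> star (eps A) = eps A"
  by (rule R_inf_eqI) (auto simp: rel_simps)

lemma eps_empty: "eps {} = 1"
  by (rule R_inf_eqI) (auto simp: rel_simps)

lemma eps_times: "finite A \<Longrightarrow> finite B \<Longrightarrow> eps A * eps B = eps (A \<union> B)"
  by (rule R_inf_eqI) (auto simp: rel_simps)

lemma eps_idem: "finite A \<Longrightarrow> eps A * eps A = eps A"
  by (simp add: eps_times)

text \<open>If x fixes n, its row n and column n meet only in the diagonal 1, and either product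
  deletes exactly that entry.\<close>

lemma eps_commute: "rel x n n \<Longrightarrow> eps {n} * x = x * eps {n}"
  by (rule R_inf_eqI) (auto simp: rel_simps dest: rel_row rel_col)

lemma rel_refl_times: "rel x n n \<Longrightarrow> rel y n n \<Longrightarrow> rel (x * y) n n"
  by (auto simp: rel_simps)

text \<open>The transposition of n and m commutes with x, which fixes both points, and conjugates
  \<open>eps {n}\<close> into \<open>eps {m}\<close>; a central function does not see the
  conjugation.\<close>

lemma central_eps_cong:
  assumes f: "central f" and n: "rel x n n" and m: "rel x m m"
  shows "f (x * eps {n}) = f (x * eps {m})"
proof -
  define t where "t = perm_elem (Transposition.transpose n m)"
  have t: "rel t i j \<longleftrightarrow> i = Transposition.transpose n m j" for i j
    unfolding t_def
    by (rule rel_perm_elem[OF permutes_swap_id[of n "{n, m}" m]]) auto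
  have tt: "t * t = 1"
    by (rule R_inf_eqI) (auto simp: rel_simps t)
  have tx: "t * x = x * t"
  proof (rule R_inf_eqI)
    fix i j
    have "rel x (Transposition.transpose n m i) j \<longleftrightarrow> rel x i (Transposition.transpose n m j)"
      using n m by (auto simp: Transposition.transpose_def dest: rel_row rel_col)
    moreover have "i = Transposition.transpose n m k \<longleftrightarrow> k = Transposition.transpose n m i" for k
      by (auto simp: transpose_eq_iff)
    ultimately show "rel (t * x) i j \<longleftrightarrow> rel (x * t) i j"
      by (simp add: rel_simps t)
  qed
  have te: "t * eps {n} * t = eps {m}"
    by (rule R_inf_eqI) (auto simp: rel_simps t Transposition.transpose_def split: if_splits)
  have "f (x * eps {n}) = f ((x * eps {n} * t) * t)"
    by (simp add: mult.assoc tt)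
  also have "\<dots> = f (t * (x * eps {n} * t))"
    using f unfolding central_def by blast
  also have "t * (x * eps {n} * t) = x * (t * eps {n} * t)"
    by (metis tx mult.assoc)
  finally show ?thesis
    by (simp add: te)
qed

section \<open>Positive definite functions and their quadratic forms\<close>

lemma positive_definite_hermitian:
  assumes "positive_definite f"
  shows "f (star y * x) = cnj (f (star x * y))"
proof -
  define r where "r = (\<lambda>i::nat. if i = 0 then x else y)"
  have "hermitian_matrix 2 (\<lambda>i j. f (star (r i) * r j))"
    using assms by (simp add: positive_definite_def)
  then have "f (star (r 1) * r 0) = cnj (f (star (r 0) * r 1))"
    unfolding hermitian_matrix_def by (metis one_less_numeral_iff semiring_norm(76) zero_less_numeral)
  then show ?thesis
    by (simp add: r_def)
qed

lemma positive_definite_form: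
  fixes n :: nat
  assumes "positive_definite f"
  shows "0 \<le> Re (\<Sum>i<n. \<Sum>j<n. cnj (z i) * f (star (r i) * r j) * z j)"
  using assms by (simp only: positive_definite_def nonneg_definite_matrix_def)

lemma positive_definiteI:
  assumes "\<And>x y. f (star y * x) = cnj (f (star x * y))"
    and "\<And>(n::nat) r z. 0 \<le> Re (\<Sum>i<n. \<Sum>j<n. cnj (z i) * f (star (r i) * r j) * z j)"
  shows "positive_definite f"
  unfolding positive_definite_def hermitian_matrix_def nonneg_definite_matrix_def
  by (intro allI impI conjI assms)

lemma positive_definite_nonneg:
  assumes f: "positive_definite f"
  shows "f 1 = complex_of_real (Re (f 1)) \<and> 0 \<le> Re (f 1)"
proof -
  have "star 1 = 1"
    by (rule R_inf_eqI) (auto simp: rel_simps)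
  then show ?thesis
    using positive_definite_hermitian[OF f, of 1 1]
      positive_definite_form[OF f, where n = 1 and z = "\<lambda>_. 1" and r = "\<lambda>_. 1"]
    by (simp add: complex_eq_iff)
qed

text \<open>Cuts a form on 2n vectors into four n by n blocks; it is applied to the r_i followed by
  their products with one projection.\<close>

lemma sum_split_pairs:
  fixes F :: "nat \<Rightarrow> nat \<Rightarrow> 'a::comm_monoid_add"
  shows "(\<Sum>i<n + n. \<Sum>j<n + n. F i j) =
    (\<Sum>i<n. \<Sum>j<n. F i j + F i (n + j) + F (n + i) j + F (n + i) (n + j))"
proof -
  have split: "(\<Sum>i<n + n. G i) = (\<Sum>i<n. G i + G (n + i))" for G :: "nat \<Rightarrow> 'a"
  proof -
    have "(\<Sum>i<n + n. G i) = (\<Sum>i<n. G i) + (\<Sum>i=0 + n..<n + n. G i)"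
      by (simp add: lessThan_atLeast0 sum.atLeastLessThan_concat)
    then show ?thesis
      unfolding sum.shift_bounds_nat_ivl by (simp add: sum.distrib lessThan_atLeast0 add.commute)
  qed
  show ?thesis
    unfolding split by (simp add: sum.distrib ac_simps)
qed

section \<open>Deleting a fixed point\<close>

text \<open>A fixed point exists because x fixes almost every n; for central f the choice is
  immaterial.\<close>

definition puncture :: "(R_inf \<Rightarrow> complex) \<Rightarrow> R_inf \<Rightarrow> complex" where
  "puncture f x = f (x * eps {SOME n. rel x n n})"

lemma puncture_eq:
  assumes "central f" "rel x n n"
  shows "puncture f x = f (x * eps {n})"
  unfolding puncture_def by (rule central_eps_cong[OF assms(1) someI assms(2)]) (rule assms(2))

lemma central_puncture:
  assumes "central f"
  shows "central (puncture f)"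
  unfolding central_def
proof (intro allI)
  fix x y
  have "\<forall>\<^sub>F n in sequentially. rel x n n \<and> rel y n n"
    by (intro eventually_conj eventually_rel_refl)
  then obtain n where n: "rel x n n" "rel y n n"
    by (auto dest: eventually_happens)
  have "f (x * y * eps {n}) = f (x * eps {n} * y)"
    using n by (simp add: mult.assoc eps_commute)
  also have "\<dots> = f (y * x * eps {n})"
    using assms unfolding central_def by (metis mult.assoc)
  finally show "puncture f (x * y) = puncture f (y * x)"
    using n by (simp add: puncture_eq[OF assms rel_refl_times])
qed

text \<open>Lets a single \<open>eps {m}\<close> represent \<open>puncture f\<close> at every entry
  of a finite matrix.\<close>

lemma obtain_common_fixpoint:
  fixes r :: "nat \<Rightarrow> R_inf"
  obtains m where "\<And>i. i < n \<Longrightarrow> rel (r i) m m"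
proof -
  have "\<forall>\<^sub>F m in sequentially. \<forall>i\<in>{..<n}. rel (r i) m m"
    by (intro eventually_ball_finite ballI eventually_rel_refl) simp
  then show ?thesis
    using that by (force dest!: eventually_happens)
qed

lemma rel_refl_star_times: "rel x n n \<Longrightarrow> rel y n n \<Longrightarrow> rel (star x * y) n n"
  by (auto simp: rel_simps)

text \<open>The projection \<open>eps {n}\<close> is self-adjoint, idempotent and commutes with
  \<open>star x * y\<close>, so it can be absorbed by either factor or by both.\<close>

lemma star_times_eps:
  assumes "rel x n n" "rel y n n"
  shows "star x * y * eps {n} = star x * (y * eps {n})"
    and "star x * y * eps {n} = star (x * eps {n}) * y"
    and "star x * y * eps {n} = star (x * eps {n}) * (y * eps {n})"
proof -
  have *: "eps {n} * (star x * y) = star x * y * eps {n}"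
    by (rule eps_commute[OF rel_refl_star_times[OF assms]])
  show "star x * y * eps {n} = star x * (y * eps {n})"
    by (simp add: mult.assoc)
  show "star x * y * eps {n} = star (x * eps {n}) * y"
    using * by (simp add: star_times star_eps mult.assoc)
  show "star x * y * eps {n} = star (x * eps {n}) * (y * eps {n})"
    using * by (metis star_times star_eps eps_idem mult.assoc finite.intros)
qed

lemma hermitian_puncture:
  assumes c: "central f" and f: "positive_definite f"
  shows "puncture f (star y * x) = cnj (puncture f (star x * y))"
proof -
  have "\<forall>\<^sub>F n in sequentially. rel x n n \<and> rel y n n"
    by (intro eventually_conj eventually_rel_refl)
  then obtain n where n: "rel x n n" "rel y n n"
    by (auto dest: eventually_happens)
  have "f (star (y * eps {n}) * (x * eps {n})) = cnj (f (star (x * eps {n}) * (y * eps {n})))"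
    by (rule positive_definite_hermitian[OF f])
  then show ?thesis
    using n by (simp add: puncture_eq[OF c rel_refl_star_times[where n = n]] star_times_eps(3))
qed

lemma positive_definite_puncture:
  assumes c: "central f" and f: "positive_definite f"
  shows "positive_definite (puncture f)"
proof (rule positive_definiteI)
  show "puncture f (star y * x) = cnj (puncture f (star x * y))" for x y
    by (rule hermitian_puncture[OF assms])
  fix n :: nat and r and z :: "nat \<Rightarrow> complex"
  obtain m where m: "\<And>i. i < n \<Longrightarrow> rel (r i) m m"
    using obtain_common_fixpoint[of n r] by blast
  \<comment> \<open>The matrix of \<open>puncture f\<close> at the r_i is that of f at the elements
    \<open>r i * eps {m}\<close>.\<close>
  have "(\<Sum>i<n. \<Sum>j<n. cnj (z i) * puncture f (star (r i) * r j) * z j) =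
      (\<Sum>i<n. \<Sum>j<n. cnj (z i) * f (star (r i * eps {m}) * (r j * eps {m})) * z j)"
    using m by (intro sum.cong refl)
      (simp add: puncture_eq[OF c rel_refl_star_times[where n = m]] star_times_eps(3))
  moreover have "0 \<le> Re (\<Sum>i<n. \<Sum>j<n. cnj (z i) * f (star (r i * eps {m}) * (r j * eps {m})) * z j)"
    by (rule positive_definite_form[OF f])
  ultimately show "0 \<le> Re (\<Sum>i<n. \<Sum>j<n. cnj (z i) * puncture f (star (r i) * r j) * z j)"
    by simp
qed

lemma positive_definite_diff_puncture:
  assumes c: "central f" and f: "positive_definite f"
  shows "positive_definite (\<lambda>x. f x - puncture f x)"
proof (rule positive_definiteI)
  show "f (star y * x) - puncture f (star y * x) = cnj (f (star x * y) - puncture f (star x * y))"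
    for x y
    by (simp add: hermitian_puncture[OF assms, of y x] positive_definite_hermitian[OF f, of y x])
  fix n :: nat and r and z :: "nat \<Rightarrow> complex"
  obtain m where m: "\<And>i. i < n \<Longrightarrow> rel (r i) m m"
    using obtain_common_fixpoint[of n r] by blast
  \<comment> \<open>The quadratic form of \<open>f\<close> at the vector \<open>\<Sum> z\<^sub>i r\<^sub>i (1 - \<epsilon>\<^bsub>{m}\<^esub>)\<close> of the semigroup algebra.\<close>
  define r' where "r' i = (if i < n then r i else r (i - n) * eps {m})" for i
  define z' where "z' i = (if i < n then z i else - z (i - n))" for i
  have "(\<Sum>i<n + n. \<Sum>j<n + n. cnj (z' i) * f (star (r' i) * r' j) * z' j) =
      (\<Sum>i<n. \<Sum>j<n. cnj (z i) * (f (star (r i) * r j) - puncture f (star (r i) * r j)) * z j)"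
    unfolding sum_split_pairs
  proof (intro sum.cong refl)
    fix i j
    assume ij: "i \<in> {..<n}" "j \<in> {..<n}"
    then have fix_ij: "rel (r i) m m" "rel (r j) m m"
      using m by auto
    have p: "puncture f (star (r i) * r j) = f (star (r i) * r j * eps {m})"
      by (rule puncture_eq[OF c rel_refl_star_times[OF fix_ij]])
    have "r' i = r i" "r' j = r j" "r' (n + i) = r i * eps {m}" "r' (n + j) = r j * eps {m}"
      "z' i = z i" "z' j = z j" "z' (n + i) = - z i" "z' (n + j) = - z j"
      using ij by (simp_all add: r'_def z'_def)
    then show "cnj (z' i) * f (star (r' i) * r' j) * z' j
        + cnj (z' i) * f (star (r' i) * r' (n + j)) * z' (n + j)
        + cnj (z' (n + i)) * f (star (r' (n + i)) * r' j) * z' j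
        + cnj (z' (n + i)) * f (star (r' (n + i)) * r' (n + j)) * z' (n + j) =
      cnj (z i) * (f (star (r i) * r j) - puncture f (star (r i) * r j)) * z j"
      \<comment> \<open>Up to the common factors, the four blocks contribute f - p - p + p, where p
        is the punctured value.\<close>
      unfolding p by (simp only: star_times_eps[OF fix_ij, symmetric]) (simp add: algebra_simps)
  qed
  moreover have "0 \<le> Re (\<Sum>i<n + n. \<Sum>j<n + n. cnj (z' i) * f (star (r' i) * r' j) * z' j)"
    by (rule positive_definite_form[OF f])
  ultimately show "0 \<le> Re (\<Sum>i<n. \<Sum>j<n. cnj (z i) *
      (f (star (r i) * r j) - puncture f (star (r i) * r j)) * z j)"
    by simp
qed

text \<open>The summands \<open>puncture f\<close> and \<open>f - puncture f\<close> of f must be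
  linearly dependent; evaluating at 1 identifies the ratio.\<close>

lemma indecomposable_puncture:
  assumes c: "central f" and f: "positive_definite f" and ind: "indecomposable f" and f1: "f 1 = 1"
  shows "puncture f x = puncture f 1 * f x"
proof -
  have "central (\<lambda>x. f x - puncture f x)"
    using c central_puncture[OF c] unfolding central_def by metis
  then have "central (puncture f) \<and> positive_definite (puncture f) \<and>
      central (\<lambda>x. f x - puncture f x) \<and> positive_definite (\<lambda>x. f x - puncture f x)"
    by (intro conjI central_puncture positive_definite_puncture positive_definite_diff_puncture c f)
  moreover have "\<forall>x. f x = puncture f x + (f x - puncture f x)"
    by simp
  ultimately have "\<not> linearly_independent_pair (puncture f) (\<lambda>x. f x - puncture f x)"
    using ind unfolding indecomposable_def by blast
  then obtain a b :: complex where ab: "a \<noteq> 0 \<or> b \<noteq> 0"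
    and *: "\<And>x. a * puncture f x + b * (f x - puncture f x) = 0"
    unfolding linearly_independent_pair_def by blast
  have **: "(b - a) * puncture f x = b * f x" for x
    using *[of x] by (simp add: algebra_simps)
  \<comment> \<open>Equality would give b = 0 at the identity, where f is 1, and then a = 0 as
    well.\<close>
  have "b \<noteq> a"
    using **[of 1] f1 ab by auto
  moreover have "(b - a) * puncture f x = (b - a) * (puncture f 1 * f x)"
    using **[of x] **[of 1] f1 by (simp flip: mult.assoc)
  ultimately show ?thesis
    by simp
qed

text \<open>A point n outside S is fixed by \<open>eps S\<close>, so adding it to S is one puncture
  and costs one factor.\<close>

lemma character_eps:
  assumes f: "indecomposable_finite_character f" and "finite S"
  shows "f (eps S) = puncture f 1 ^ card S"
  using assms(2)
proof (induction rule: finite_induct)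
  case empty
  then show ?case
    using f by (simp add: eps_empty indecomposable_finite_character_def)
next
  case (insert n S)
  have "eps (insert n S) = eps S * eps {n}"
    using insert.hyps by (simp add: eps_times)
  moreover have "rel (eps S) n n"
    using insert.hyps by (simp add: rel_simps)
  ultimately have "f (eps (insert n S)) = puncture f (eps S)"
    using f by (simp add: puncture_eq indecomposable_finite_character_def)
  also have "\<dots> = puncture f 1 * f (eps S)"
    using f indecomposable_puncture unfolding indecomposable_finite_character_def by blast
  finally show ?case
    using insert by simp
qed

section \<open>Quasicycles\<close>

lemma funpow_cycle_of_list_eq_nth:
  assumes "cycle ns" "x \<in> set ns" "y \<in> set ns"
  shows "\<exists>n. (cycle_of_list ns ^^ n) x = y"
proof -
  obtain i j where i: "i < length ns" "x = ns ! i" and j: "j < length ns" "y = ns ! j"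
    using assms(2,3) by (metis in_set_conv_nth)
  \<comment> \<open>From position i, \<open>length ns - i\<close> steps wrap around to position 0,
    and j more reach y.\<close>
  define n where "n = length ns - i + j"
  have "(cycle_of_list ns ^^ n) x = map (cycle_of_list ns ^^ n) ns ! i"
    using i by simp
  also have "\<dots> = rotate n ns ! i"
    by (simp add: cyclic_rotation[OF assms(1)])
  also have "\<dots> = ns ! ((n + i) mod length ns)"
    using i by (simp add: nth_rotate add.commute)
  also have "n + i = length ns + j"
    using i by (simp add: n_def)
  finally show ?thesis
    using j by (metis mod_add_self1 mod_less)
qed

text \<open>Enlarging A by its preimage under the cycle keeps the value of f, and the complement of
  A in the support shrinks until A is everything.\<close>

lemma central_quasicycle:
  assumes f: "central f" and ns: "cycle ns"
  shows "A \<subseteq> set ns \<Longrightarrow> A \<noteq> {} \<Longrightarrow>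
    f (perm_elem (cycle_of_list ns) * eps A) = f (eps (set ns))"
proof (induction "card (set ns - A)" arbitrary: A rule: less_induct)
  case less
  let ?c = "cycle_of_list ns"
  have c: "?c permutes set ns"
    by (rule cycle_permutes)
  have rel_c: "rel (perm_elem ?c) i j \<longleftrightarrow> i = ?c j" for i j
    by (rule rel_perm_elem[OF c]) simp
  \<comment> \<open>The points of B are those that \<open>eps A\<close> kills before or after the
    cycle is applied.\<close>
  define B where "B = A \<union> ?c -` A"
  have fin: "finite A"
    using less.prems finite_subset by blast
  have B: "B \<subseteq> set ns"
    using less.prems permutes_in_image[OF c] unfolding B_def by auto
  then have finB: "finite B"
    using finite_subset by blast
  show ?case
  proof (cases "B = A")
    case True
    obtain a where a: "a \<in> A"
      using less.prems by blast
    \<comment> \<open>Now A is closed under preimages, and the orbit of every point of the support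
      passes through a.\<close>
    have pre: "x \<in> A" if "(?c ^^ n) x \<in> A" for n x
      using that True unfolding B_def by (induction n arbitrary: x) auto
    have "x \<in> A" if "x \<in> set ns" for x
      using funpow_cycle_of_list_eq_nth[OF ns that, of a] less.prems a pre by auto
    then have "A = set ns"
      using less.prems by blast
    moreover have "perm_elem ?c * eps (set ns) = eps (set ns)"
      by (rule R_inf_eqI) (auto simp: rel_simps rel_c permutes_not_in[OF c])
    ultimately show ?thesis
      by simp
  next
    case False
    then have "A \<subset> B"
      unfolding B_def by blast
    then have "set ns - B \<subset> set ns - A"
      using B by blast
    then have "card (set ns - B) < card (set ns - A)"
      by (intro psubset_card_mono) auto
    then have IH: "f (perm_elem ?c * eps B) = f (eps (set ns))"
      using less.hyps B less.prems unfolding B_def by blast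
    have rel_B: "rel (eps B) i j \<longleftrightarrow> i = j \<and> i \<notin> A \<and> ?c i \<notin> A" for i j
      unfolding rel_eps[OF finB] by (simp add: B_def)
    \<comment> \<open>Doubling the idempotent lets centrality carry one copy to the left of the
      cycle.\<close>
    have "f (perm_elem ?c * eps A) = f ((perm_elem ?c * eps A) * eps A)"
      by (simp add: mult.assoc eps_idem[OF fin])
    also have "\<dots> = f (eps A * (perm_elem ?c * eps A))"
      using f unfolding central_def by blast
    also have "eps A * (perm_elem ?c * eps A) = perm_elem ?c * eps B"
      by (rule R_inf_eqI) (auto simp: rel_times rel_eps[OF fin] rel_B rel_c)
    finally show ?thesis
      using IH by simp
  qed
qed

theorem corollary6:
  fixes f :: "R_inf \<Rightarrow> complex"
  assumes "indecomposable_finite_character f"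
  shows "\<exists>\<rho>::real. \<rho> \<in> {0..1} \<and>
           (\<forall>ns A q. quasicycle ns A q \<and> A \<noteq> {} \<longrightarrow>
              f q = complex_of_real \<rho> ^ card (set ns))"
proof -
  have f: "central f" "positive_definite f" "f 1 = 1"
    using assms by (auto simp: indecomposable_finite_character_def)
  define \<rho> where "\<rho> = Re (puncture f 1)"
  \<comment> \<open>Both summands of f are nonnegative at 1 and add up to 1, which bounds
    \<open>\<rho>\<close> from both sides.\<close>
  have "puncture f 1 = complex_of_real \<rho> \<and> 0 \<le> \<rho>" "0 \<le> Re (1 - puncture f 1)"
    using positive_definite_nonneg[OF positive_definite_puncture[OF f(1,2)]]
      positive_definite_nonneg[OF positive_definite_diff_puncture[OF f(1,2)]] f(3) by (simp_all add: \<rho>_def)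
  then have \<rho>: "puncture f 1 = complex_of_real \<rho>" "\<rho> \<in> {0..1}"
    by (auto simp: \<rho>_def)
  have "f q = complex_of_real \<rho> ^ card (set ns)" if "quasicycle ns A q" "A \<noteq> {}" for ns A q
  proof -
    have "f q = f (eps (set ns))"
      using that central_quasicycle[OF f(1)] unfolding quasicycle_def by blast
    then show ?thesis
      using character_eps[OF assms, of "set ns"] \<rho>(1) by simp
  qed
  then show ?thesis
    using \<rho>(2) by blast
qed

end
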